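(* Let $f:\mathbb{R}^d\to\mathbb{R}$ be convex with $\|\nabla f(x)-\nabla f(y)\|_2\le L\|x-y\|_2$ for all $x,y$, let $r:\mathbb{R}^d\to\mathbb{R}\cup\{+\infty\}$ be convex, and let $F=f+r$ have non-empty solution set $\mathcal{X}^\star=\{x^\star:F(x^\star)=F^\star\}$, $F^\star=\min_xF(x)$. Suppose $F$ is coercive (for any sequence $\{x_k\}$, $\lim_k\|x_k-\mathrm{P}_\star(x_k)\|_2=+\infty$ implies $\lim_kF(x_k)=+\infty$) and $\partial F$ is coercive with respect to $F$ (for any sequence $\{x_k\}$, $\lim_kF(x_k)=+\infty$ implies $\lim_k\inf_{u\in\partial F(x_k)}\|u\|_2=+\infty$). Let $x_{k+1}=\mathrm{prox}_{\alpha r}(x_k-\alpha\hat g_k)$, with the proximal operator computed exactly, $\alpha=\frac1L$, and $\|\nabla f(x_k)-\hat g_k\|_2^2\le\varepsilon_{\mathrm{abs}}$ for all $k$. Let $e_k=F(x_k)-F^\star$. Then $$e_k\le\max\left\{\frac{36LR^2e_0}{e_0(k-t)+36LR^2},\ R\sqrt{10\varepsilon_{\mathrm{abs}}}\right\}\quad\text{for }k\ge t,$$ where $t=\left\lceil\frac{\log(2e_0/3)}{\log(3/2)}\right\rceil$ and $R$ is a constant, determined by the two coercivity conditions, satisfying $\|x_k-\mathrm{P}_\star(x_k)\|_2\le R$ for all $k$. If instead of the two coercivity conditions $F$ is restricted $\nu$-strongly convex, i.e. $F(x)-\min F\ge\frac\nu2\|x-\mathrm{P}_\star(x)\|_2^2$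 for all $x\in\mathbb{R}^d$, then $$e_k\le\left(\frac{24L}{\nu+24L}\right)^ke_0+\frac{20\varepsilon_{\mathrm{abs}}}{\nu}.$$
   Context: $\mathrm{prox}_{\alpha r}(x)=\mathrm{argmin}_{y\in\mathbb{R}^d}\frac12\|x-y\|_2^2+\alpha r(y)$. $\mathrm{P}_\star(x)=\mathrm{argmin}_{y\in\mathcal{X}^\star}\|y-x\|_2$. $\partial F(x)=\nabla f(x)+\partial r(x)$, where $\partial r$ is the convex subdifferential. $\varepsilon_{\mathrm{abs}}\ge0$ is a fixed constant independent of $k$.
   Formalization: The index t is taken as max{0, ⌈log(2e_0/3)/log(3/2)⌉}: with a negative t (0 < e_0 ≤ 1) the first estimate at k = 0 with ε_abs = 0 would read e_0 < e_0, which is false. *)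

theory Defs
  imports "HOL-Analysis.Analysis"
begin

definition ereal_convex :: "('a::real_vector \<Rightarrow> ereal) \<Rightarrow> bool" where
  "ereal_convex r \<longleftrightarrow>
     (\<forall>x y u v. 0 \<le> u \<longrightarrow> 0 \<le> v \<longrightarrow> u + v = 1 \<longrightarrow>
        r (u *\<^sub>R x + v *\<^sub>R y) \<le> ereal u * r x + ereal v * r y)"

definition composite :: "('a \<Rightarrow> real) \<Rightarrow> ('a \<Rightarrow> ereal) \<Rightarrow> 'a \<Rightarrow> ereal" where
  "composite f r x = ereal (f x) + r x"

definition opt_value :: "('a \<Rightarrow> ereal) \<Rightarrow> ereal" where
  "opt_value F = (INF x. F x)"

(* opt_value is an infimum; it is a minimum exactly when this set is non-empty. *)
definition solution_set :: "('a \<Rightarrow> ereal) \<Rightarrow> 'a set" where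
  "solution_set F = {x. F x = opt_value F}"

(* Relational, since argmin presupposes existence: P sends every point to a nearest
   point of X. *)
definition projects_onto :: "('a::real_normed_vector \<Rightarrow> 'a) \<Rightarrow> 'a set \<Rightarrow> bool" where
  "projects_onto P X \<longleftrightarrow> (\<forall>x. is_arg_min (\<lambda>y. norm (y - x)) (\<lambda>y. y \<in> X) (P x))"

(* p = prox_{a r}(v) *)
definition is_prox :: "real \<Rightarrow> ('a::real_normed_vector \<Rightarrow> ereal) \<Rightarrow> 'a \<Rightarrow> 'a \<Rightarrow> bool" where
  "is_prox a r v p \<longleftrightarrow>
     is_arg_min (\<lambda>y. ereal (1 / 2 * (norm (v - y))\<^sup>2) + ereal a * r y) (\<lambda>_. True) p"

definition subdifferential :: "('a::real_inner \<Rightarrow> ereal) \<Rightarrow> 'a \<Rightarrow> 'a set" where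
  "subdifferential r x = {v. \<forall>y. r x + ereal (v \<bullet> (y - x)) \<le> r y}"

definition composite_subdifferential ::
    "('a::real_inner \<Rightarrow> 'a) \<Rightarrow> ('a \<Rightarrow> ereal) \<Rightarrow> 'a \<Rightarrow> 'a set" where
  "composite_subdifferential gradf r x = (\<lambda>v. gradf x + v) ` subdifferential r x"

definition coercive :: "('a::real_normed_vector \<Rightarrow> ereal) \<Rightarrow> ('a \<Rightarrow> 'a) \<Rightarrow> bool" where
  "coercive F P \<longleftrightarrow>
     (\<forall>y :: nat \<Rightarrow> 'a. filterlim (\<lambda>k. norm (y k - P (y k))) at_top sequentially \<longrightarrow>
        (\<lambda>k. F (y k)) \<longlonglongrightarrow> \<infinity>)"

(* The infimum is taken in ereal, so it is +infinity over an empty subdifferential. *)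
definition subdiff_coercive ::
    "('a::real_normed_vector \<Rightarrow> ereal) \<Rightarrow> ('a \<Rightarrow> 'a set) \<Rightarrow> bool" where
  "subdiff_coercive F dF \<longleftrightarrow>
     (\<forall>y :: nat \<Rightarrow> 'a. (\<lambda>k. F (y k)) \<longlonglongrightarrow> \<infinity> \<longrightarrow>
        (\<lambda>k. INF u\<in>dF (y k). ereal (norm u)) \<longlonglongrightarrow> \<infinity>)"

definition restricted_strongly_convex ::
    "real \<Rightarrow> ('a::real_normed_vector \<Rightarrow> ereal) \<Rightarrow> ('a \<Rightarrow> 'a) \<Rightarrow> bool" where
  "restricted_strongly_convex \<nu> F P \<longleftrightarrow>
     (\<forall>x. F x - opt_value F \<ge> ereal (\<nu> / 2 * (norm (x - P x))\<^sup>2))"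

(* x is a run from x0 with step size 1/L, driven by gradient estimates g. *)
definition inexact_prox_gradient ::
    "('a::real_normed_vector \<Rightarrow> 'a) \<Rightarrow> ('a \<Rightarrow> ereal) \<Rightarrow> real \<Rightarrow> real \<Rightarrow> 'a \<Rightarrow>
     (nat \<Rightarrow> 'a) \<Rightarrow> (nat \<Rightarrow> 'a) \<Rightarrow> bool" where
  "inexact_prox_gradient gradf r L \<epsilon> x0 x g \<longleftrightarrow>
     x 0 = x0 \<and>
     (\<forall>k. (norm (gradf (x k) - g k))\<^sup>2 \<le> \<epsilon>) \<and>
     (\<forall>k. is_prox (1 / L) r (x k - (1 / L) *\<^sub>R g k) (x (Suc k)))"

(* The burn-in index ceil(log(2 e0/3) / log(3/2)) counts iterations, so it is 0 when the
   ceiling is negative (small e0).  Keeping a negative value would be wrong: for k = 0 and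
   exact gradients the rate below would then read e0 < e0.  At e0 = 0, where the index is
   formally -infinity, ln 0 = 0 gives the same value 0. *)
definition burn_in :: "real \<Rightarrow> nat" where
  "burn_in e0 = nat \<lceil>ln (2 * e0 / 3) / ln (3 / 2)\<rceil>"

end

theory Submission
  imports Defs
begin

text \<open>
  Write \<open>p\<close> for the step taken from \<open>x\<close>, \<open>e\<close> and \<open>E\<close> for the optimality gaps of \<open>x\<close> and \<open>p\<close>, and
  \<open>s = sqrt \<epsilon>\<close> for the bound on the gradient error. Two inequalities drive everything. The
  three-point inequality \<open>step_three_point\<close> compares \<open>F p\<close> with \<open>F y\<close> for every \<open>y\<close>;
  choosing \<open>y\<close> on the segment from \<open>x\<close> to a solution at distance \<open>D\<close> gives
  \<open>E \<le> (1 - t) * e + L / 2 * t\<^sup>2 * D\<^sup>2 + s\<^sup>2 / (2 * L)\<close>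
  for all \<open>t\<close> in the unit interval. The residual bound says that \<open>\<partial>F p\<close>
  has an element of norm at most \<open>L * norm (x - p) + s\<close>, so that a large gap at \<open>p\<close> forces a long
  step.

  In the first inequality the noise enters as \<open>s\<^sup>2 / (2 * L)\<close>, while the noise levels in the two
  claims, \<open>R * sqrt (10 * \<epsilon>)\<close> and \<open>20 * \<epsilon> / \<nu>\<close>, do not grow when \<open>L\<close> becomes small. They can
  nevertheless be compared whenever \<open>E\<close> is above such a level: both levels guarantee
  \<open>E\<^sup>2 \<ge> 10 * s\<^sup>2 * D'\<^sup>2\<close>, where \<open>D'\<close> is the distance from \<open>p\<close> to a solution. By the residual bound the
  step is then so long that noise cannot account for it. Hence \<open>F\<close> decreases, and the three-point
  inequality at a solution leaves room only for \<open>E \<le> 2 * L * D\<^sup>2\<close> (lemma \<open>step_above_noise\<close>). If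
  \<open>D \<le> R\<close>, this makes the noise term a small fraction of \<open>E\<close>, and a suitable \<open>t\<close> shows that the
  reciprocal gap grows by at least \<open>9 / (20 * L * R\<^sup>2)\<close> (lemma \<open>reciprocal_gap_growth\<close>). If
  \<open>D\<^sup>2 \<le> 2 * e / \<nu>\<close>, the gap shrinks by the factor \<open>24 * L / (\<nu> + 24 * L)\<close>: for large \<open>\<nu>\<close> by
  \<open>E \<le> 2 * L * D\<^sup>2\<close> itself, and for small \<open>\<nu>\<close> by a suitable \<open>t\<close> (lemma \<open>linear_gap_decrease\<close>).

  The uniform bound \<open>R\<close> comes from the two coercivity conditions. The first iterate has a value bounded
  independently of the gradient estimates. Above a certain level all subgradients of \<open>F\<close> are long, so
  a step that ends there is long as well and does not increase \<open>F\<close>. All later values thus stay below a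
  fixed level, and on a sublevel set the distance to the solutions is bounded.
\<close>

section \<open>Scalar inequalities behind the rates\<close>

text \<open>Here \<open>a\<close>, \<open>h\<close>, \<open>D\<close> stand for \<open>L\<close> times the step length and the distances of \<open>p\<close> and \<open>x\<close> to a
  solution, and \<open>E\<close> for \<open>L\<close> times the new gap. Bounding \<open>s * h - h\<^sup>2 / 2\<close> by its maximum
  \<open>s\<^sup>2 / 2\<close> suffices for \<open>D \<ge> s\<close>, but not if \<open>D\<close> is much smaller than \<open>s\<close>. If \<open>D < s\<close>, however,
  a long step ends far from the solution, beyond the maximiser \<open>h = s\<close>, and past
  \<open>h = 54 / 25 * s - D\<close> the expression has dropped to at most \<open>3 / 2 * D\<^sup>2\<close>.\<close>

lemma steep_step_bound:
  fixes a h D s E :: real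
  assumes E: "E \<le> s * h + (D\<^sup>2 - h\<^sup>2) / 2"
    and h: "a \<le> D + h" and steep: "54 / 25 * s \<le> a" and s: "0 \<le> s" and D: "0 \<le> D"
  shows "E \<le> 2 * D\<^sup>2"
proof (cases "s \<le> D")
  case True
  have "s * h - h\<^sup>2 / 2 \<le> s\<^sup>2 / 2"
    using zero_le_power2[of "s - h"] by (simp add: power2_diff)
  moreover have "s\<^sup>2 \<le> D\<^sup>2" "0 \<le> D\<^sup>2"
    using True s by (auto intro!: power_mono)
  ultimately show ?thesis
    using E unfolding diff_divide_distrib by linarith
next
  case False
  define h0 where "h0 = 54 / 25 * s - D"
  have h0: "s \<le> h0" "h0 \<le> h"
    using False h steep s unfolding h0_def by auto
  have "0 \<le> (h - h0) * (h + h0 - 2 * s)"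
    using h0 by (intro mult_nonneg_nonneg) auto
  then have "s * h - h\<^sup>2 / 2 \<le> s * h0 - h0\<^sup>2 / 2"
    by (simp add: algebra_simps power2_eq_square)
  also have "\<dots> \<le> 3 / 2 * D\<^sup>2"
  proof -
    \<comment> \<open>A quadratic form in \<open>D\<close> and \<open>s\<close> that is positive definite because \<open>54 / 25\<close> exceeds
      \<open>1 + 2 / sqrt 3\<close>.\<close>
    have "3 / 2 * D\<^sup>2 - (s * h0 - h0\<^sup>2 / 2) = 2 * (D - 29 / 100 * s)\<^sup>2 + 23 / 5000 * s\<^sup>2"
      unfolding h0_def by (simp add: power2_eq_square field_simps)
    then show ?thesis
      using zero_le_power2[of s] zero_le_power2[of "D - 29 / 100 * s"] by linarith
  qed
  finally show ?thesis
    using E by (simp add: diff_divide_distrib)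
qed

text \<open>The choice \<open>t = e / N\<close> minimises the right-hand side of the contraction and yields
  \<open>E \<le> e - 9 * e\<^sup>2 / (20 * N)\<close>. If it is not available because \<open>e > N\<close>, then \<open>t = 1\<close> alone brings the
  gap below \<open>5 / 9 * N\<close>; this uses \<open>E \<le> 2 * N\<close> to make the noise term at most \<open>E / 10\<close>.\<close>

lemma reciprocal_gap_growth:
  fixes e E N :: real
  assumes E: "0 < E" "E \<le> e" "E \<le> 2 * N"
    and contraction: "\<And>t. 0 \<le> t \<Longrightarrow> t \<le> 1 \<Longrightarrow> E \<le> (1 - t) * e + N / 2 * t\<^sup>2 + E\<^sup>2 / (20 * N)"
  shows "1 / e + 9 / (20 * N) \<le> 1 / E"
proof (cases "e \<le> N")
  case True
  have pos: "0 < N" "0 < e"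
    using E by auto
  have "E \<le> (1 - e / N) * e + N / 2 * (e / N)\<^sup>2 + E\<^sup>2 / (20 * N)"
    using pos True by (intro contraction) auto
  also have "\<dots> = e - e\<^sup>2 / (2 * N) + E\<^sup>2 / (20 * N)"
    using pos by (simp add: field_simps power2_eq_square)
  also have "\<dots> \<le> e - 9 * e\<^sup>2 / (20 * N)"
  proof -
    have "E\<^sup>2 / (20 * N) \<le> e\<^sup>2 / (20 * N)"
      using pos E by (intro divide_right_mono power_mono) auto
    then show ?thesis
      using pos by (simp add: field_simps)
  qed
  finally have "9 * e\<^sup>2 / (20 * N) \<le> e - E"
    by simp
  moreover have "9 * (e * E) / (20 * N) \<le> 9 * e\<^sup>2 / (20 * N)"
    using pos E by (intro divide_right_mono) (auto simp: power2_eq_square)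
  ultimately have "9 / (20 * N) * (e * E) \<le> e - E"
    by simp
  then have "9 / (20 * N) \<le> (e - E) / (e * E)"
    using pos E by (simp add: pos_le_divide_eq)
  also have "\<dots> = 1 / E - 1 / e"
    using pos E by (simp add: diff_divide_distrib)
  finally show ?thesis
    by simp
next
  case False
  have N: "0 < N"
    using E by auto
  have "E \<le> N / 2 + E\<^sup>2 / (20 * N)"
    using contraction[of 1] by simp
  also have "E\<^sup>2 / (20 * N) \<le> E * (2 * N) / (20 * N)"
    using E N by (intro divide_right_mono) (auto simp: power2_eq_square)
  finally have "9 * E \<le> 5 * N"
    using N by simp
  then have "9 / (5 * N) \<le> 1 / E"
    using N E by (simp add: field_simps)
  moreover have "1 / e \<le> 1 / N"
    using False N by (simp add: frac_le)
  moreover have "1 / N + 9 / (20 * N) \<le> 9 / (5 * N)"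
    using N by (simp add: field_simps)
  ultimately show ?thesis
    by linarith
qed

text \<open>For \<open>\<nu> \<ge> 5 * L\<close> the bound \<open>far\<close> already implies the claim, whereas the noise term \<open>\<nu> * E / (40 * L)\<close> may
  exceed \<open>E\<close>; for smaller \<open>\<nu>\<close> the noise term is at most \<open>E / 8\<close>. The value of \<open>t\<close> used then is close to the
  minimiser \<open>\<nu> / (2 * L)\<close> for small \<open>\<nu>\<close> and stays below one.\<close>

lemma linear_gap_decrease:
  fixes e E \<nu> L :: real
  assumes e: "0 \<le> e" and L_pos: "0 < L" and \<nu>: "0 < \<nu>" and far: "E \<le> 4 * L * e / \<nu>"
    and contraction: "\<And>t. 0 \<le> t \<Longrightarrow> t \<le> 1 \<Longrightarrow>
      E \<le> (1 - t) * e + L * t\<^sup>2 * e / \<nu> + \<nu> * E / (40 * L)"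
  shows "E \<le> 24 * L / (\<nu> + 24 * L) * e"
proof (cases "5 * L \<le> \<nu>")
  case True
  have "4 * L / \<nu> \<le> 24 * L / (\<nu> + 24 * L)"
    using True \<nu> L_pos by (simp add: field_simps)
  then have "4 * L / \<nu> * e \<le> 24 * L / (\<nu> + 24 * L) * e"
    using e by (rule mult_right_mono)
  then show ?thesis
    using far by simp
next
  case False
  \<comment> \<open>The inverse condition number.\<close>
  define n where "n = \<nu> / L"
  have n: "0 < n" "n < 5" "\<nu> = n * L"
    using False \<nu> L_pos unfolding n_def by (auto simp: field_simps)
  define t where "t = n / (n + 2)"
  have "E \<le> (1 - t) * e + L * t\<^sup>2 * e / \<nu> + \<nu> * E / (40 * L)"
    using n unfolding t_def by (intro contraction) (auto simp: field_simps)
  also have "\<dots> = (1 - t + t\<^sup>2 / n) * e + n * E / 40"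
    using L_pos n(1) by (simp add: n(3) field_simps)
  also have "1 - t + t\<^sup>2 / n = (3 * n + 4) / (n + 2)\<^sup>2"
  proof -
    have "t\<^sup>2 / n = n / (n + 2)\<^sup>2"
      using n(1) unfolding t_def by (simp add: power2_eq_square)
    moreover have "1 - t = 2 * (n + 2) / (n + 2)\<^sup>2"
    proof -
      have "1 - t = 2 / (n + 2)"
        using n(1) unfolding t_def by (simp add: field_simps)
      also have "\<dots> = (n + 2) * 2 / ((n + 2) * (n + 2))"
        using n(1) by (subst mult_divide_mult_cancel_left) auto
      finally show ?thesis
        by (simp add: power2_eq_square)
    qed
    ultimately show ?thesis
      by (simp add: add_divide_distrib[symmetric])
  qed
  finally have "(40 - n) * E \<le> 40 * ((3 * n + 4) / (n + 2)\<^sup>2 * e)"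
    by (simp add: left_diff_distrib)
  then have "(40 - n) * E \<le> 40 * (3 * n + 4) / (n + 2)\<^sup>2 * e"
    by (simp only: mult.assoc times_divide_eq_right times_divide_eq_left)
  also have "\<dots> \<le> (40 - n) * (24 / (n + 24)) * e"
  proof (rule mult_right_mono[OF _ e])
    have "40 * (3 * n + 4) * (n + 24) \<le> (40 - n) * 24 * (n + 2)\<^sup>2"
    proof -
      have "0 \<le> n\<^sup>2 * (5 - n)" "0 \<le> n\<^sup>2"
        using n by auto
      moreover have "(40 - n) * 24 * (n + 2)\<^sup>2 - 40 * (3 * n + 4) * (n + 24)
          = 24 * (n\<^sup>2 * (5 - n)) + 624 * n\<^sup>2 + 704 * n"
        by (simp add: algebra_simps power2_eq_square)
      ultimately show ?thesis
        using n(1) by linarith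
    qed
    then show "40 * (3 * n + 4) / (n + 2)\<^sup>2 \<le> (40 - n) * (24 / (n + 24))"
      using n(1) by (simp add: divide_le_eq pos_le_divide_eq)
  qed
  finally have "(40 - n) * E \<le> (40 - n) * (24 / (n + 24) * e)"
    by (simp only: mult.assoc)
  then have "E \<le> 24 / (n + 24) * e"
    by (rule mult_left_le_imp_le) (use n(2) in simp)
  moreover have "24 / (n + 24) = 24 * L / (\<nu> + 24 * L)"
  proof -
    have "24 * L / (\<nu> + 24 * L) = 24 * L / ((n + 24) * L)"
      by (simp add: n(3) distrib_right)
    also have "\<dots> = 24 / (n + 24)"
      using L_pos by simp
    finally show ?thesis ..
  qed
  ultimately show ?thesis
    by simp
qed

section \<open>Coercivity in terms of sublevel sets\<close>

lemma coercive_sublevel_bounded: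
  assumes "coercive F P"
  obtains R where "\<And>y. F y \<le> ereal c \<Longrightarrow> norm (y - P y) \<le> R"
proof -
  have "\<exists>R. \<forall>y. F y \<le> ereal c \<longrightarrow> norm (y - P y) \<le> R"
  proof (rule ccontr)
    assume "\<not> ?thesis"
    then have "\<forall>n::nat. \<exists>y. F y \<le> ereal c \<and> real n \<le> norm (y - P y)"
      by (meson linear)
    then obtain Y where Y: "\<And>n. F (Y n) \<le> ereal c" "\<And>n. real n \<le> norm (Y n - P (Y n))"
      by metis
    have "filterlim (\<lambda>n. norm (Y n - P (Y n))) at_top sequentially"
      by (rule filterlim_at_top_mono[OF filterlim_real_sequentially]) (simp add: Y(2))
    with assms have "(\<lambda>n. F (Y n)) \<longlonglongrightarrow> \<infinity>"
      unfolding coercive_def by blast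
    then have "\<forall>\<^sub>F n in sequentially. ereal c < F (Y n)"
      by (rule order_tendstoD) simp
    then obtain n where "ereal c < F (Y n)"
      using eventually_happens' sequentially_bot by blast
    with Y(1)[of n] show False
      by simp
  qed
  then show ?thesis
    using that by blast
qed

lemma subgradients_large_on_high_levels:
  assumes "subdiff_coercive F dF"
  obtains c where "\<And>y u. ereal c \<le> F y \<Longrightarrow> u \<in> dF y \<Longrightarrow> K < norm u"
proof -
  have "\<exists>c. \<forall>y u. ereal c \<le> F y \<longrightarrow> u \<in> dF y \<longrightarrow> K < norm u"
  proof (rule ccontr)
    assume "\<not> ?thesis"
    then have "\<forall>n::nat. \<exists>y. ereal (real n) \<le> F y \<and>
        (\<exists>u \<in> dF y. norm u \<le> K)"
      by (meson not_less)
    then obtain Y where Y: "\<And>n. ereal (real n) \<le> F (Y n)"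
      "\<And>n. \<exists>u \<in> dF (Y n). norm u \<le> K"
      by metis
    have "(\<lambda>n. F (Y n)) \<longlonglongrightarrow> \<infinity>"
    proof (rule tendsto_sandwich)
      show "(\<lambda>n. ereal (real n)) \<longlonglongrightarrow> \<infinity>"
        using filterlim_real_sequentially by (simp add: tendsto_PInfty_eq_at_top)
    qed (use Y(1) in auto)
    with assms have "(\<lambda>n. INF u\<in>dF (Y n). ereal (norm u)) \<longlonglongrightarrow> \<infinity>"
      unfolding subdiff_coercive_def by blast
    then have "\<forall>\<^sub>F n in sequentially.
        ereal K < (INF u\<in>dF (Y n). ereal (norm u))"
      by (rule order_tendstoD) simp
    then obtain n where n: "ereal K < (INF u\<in>dF (Y n). ereal (norm u))"
      using eventually_happens' sequentially_bot by blast
    obtain u where u: "u \<in> dF (Y n)" "norm u \<le> K"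
      using Y(2) by blast
    have "(INF u\<in>dF (Y n). ereal (norm u)) \<le> ereal K"
      using u by (intro INF_lower2[OF u(1)]) simp
    with n show False
      by simp
  qed
  then show ?thesis
    using that by blast
qed

section \<open>Smooth convex functions\<close>

locale composite_problem =
  fixes f :: "'a::real_inner \<Rightarrow> real"
    and gradf :: "'a \<Rightarrow> 'a"
    and r :: "'a \<Rightarrow> ereal"
    and L :: real
  assumes f_convex: "convex_on UNIV f"
    and f_grad: "GDERIV f x :> gradf x"
    and L_pos: "L > 0"
    and f_smooth: "norm (gradf x - gradf y) \<le> L * norm (x - y)"
    and r_range: "r x \<noteq> -\<infinity>"
    and r_convex: "ereal_convex r"
begin

abbreviation F :: "'a \<Rightarrow> ereal" where "F \<equiv> composite f r"

lemma has_derivative_along_line: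
  "((\<lambda>t. f (x + t *\<^sub>R d)) has_real_derivative gradf (x + t *\<^sub>R d) \<bullet> d) (at t)"
proof -
  have "(f has_derivative (\<lambda>h. h \<bullet> gradf (x + t *\<^sub>R d))) (at (x + t *\<^sub>R d))"
    using f_grad[of "x + t *\<^sub>R d"] by (simp add: gderiv_def)
  moreover have "((\<lambda>t. x + t *\<^sub>R d) has_derivative (\<lambda>h. h *\<^sub>R d)) (at t)"
    by (auto intro!: derivative_eq_intros)
  ultimately have "((\<lambda>t. f (x + t *\<^sub>R d)) has_derivative
      (\<lambda>h. (h *\<^sub>R d) \<bullet> gradf (x + t *\<^sub>R d))) (at t)"
    by (rule has_derivative_compose[rotated])
  moreover have "(\<lambda>h. (h *\<^sub>R d) \<bullet> gradf (x + t *\<^sub>R d)) = (*) (gradf (x + t *\<^sub>R d) \<bullet> d)"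
    by (simp add: fun_eq_iff inner_commute)
  ultimately show ?thesis
    by (simp add: has_field_derivative_def)
qed

lemma above_tangent: "f x + gradf x \<bullet> (y - x) \<le> f y"
proof -
  have "convex_on UNIV (\<lambda>t. f (x + t *\<^sub>R (y - x)))"
  proof (rule convex_onI)
    fix t u v :: real
    assume "0 < t" "t < 1"
    then have "f ((1 - t) *\<^sub>R (x + u *\<^sub>R (y - x)) + t *\<^sub>R (x + v *\<^sub>R (y - x)))
        \<le> (1 - t) * f (x + u *\<^sub>R (y - x)) + t * f (x + v *\<^sub>R (y - x))"
      by (intro convex_onD[OF f_convex]) auto
    then show "f (x + ((1 - t) *\<^sub>R u + t *\<^sub>R v) *\<^sub>R (y - x))
        \<le> (1 - t) * f (x + u *\<^sub>R (y - x)) + t * f (x + v *\<^sub>R (y - x))"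
      by (simp add: algebra_simps)
  qed auto
  from convex_on_imp_above_tangent[OF this, of 0 1 "gradf x \<bullet> (y - x)"]
  show ?thesis
    using has_derivative_along_line[of x "y - x" 0] by simp
qed

lemma below_parabola: "f y \<le> f x + gradf x \<bullet> (y - x) + L / 2 * (norm (y - x))\<^sup>2"
proof -
  let ?d = "y - x"
  let ?\<psi> = "\<lambda>t. f (x + t *\<^sub>R ?d) - (t * (gradf x \<bullet> ?d) + L / 2 * t\<^sup>2 * (norm ?d)\<^sup>2)"
  have "?\<psi> 1 \<le> ?\<psi> 0"
  proof (rule DERIV_nonpos_imp_nonincreasing[of 0 1 ?\<psi>])
    fix t :: real
    assume t: "0 \<le> t"
    have "((\<lambda>t. t * a + L / 2 * t\<^sup>2 * b) has_real_derivative a + L * t * b) (at t)" for a b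
      by (auto intro!: derivative_eq_intros)
    then have "(?\<psi> has_real_derivative
        gradf (x + t *\<^sub>R ?d) \<bullet> ?d - (gradf x \<bullet> ?d + L * t * (norm ?d)\<^sup>2)) (at t)"
      by (intro DERIV_diff has_derivative_along_line)
    moreover have "(gradf (x + t *\<^sub>R ?d) - gradf x) \<bullet> ?d \<le> L * t * (norm ?d)\<^sup>2"
    proof -
      have "(gradf (x + t *\<^sub>R ?d) - gradf x) \<bullet> ?d
          \<le> norm (gradf (x + t *\<^sub>R ?d) - gradf x) * norm ?d"
        by (rule norm_cauchy_schwarz)
      also have "\<dots> \<le> (L * norm (x + t *\<^sub>R ?d - x)) * norm ?d"
        by (intro mult_right_mono f_smooth) simp
      also have "\<dots> = L * t * (norm ?d)\<^sup>2"
        using t by (simp add: power2_eq_square)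
      finally show ?thesis .
    qed
    ultimately show "\<exists>z. (?\<psi> has_real_derivative z) (at t) \<and> z \<le> 0"
      by (intro exI[of _ "gradf (x + t *\<^sub>R ?d) \<bullet> ?d - (gradf x \<bullet> ?d + L * t * (norm ?d)\<^sup>2)"])
        (simp add: inner_diff_left)
  qed simp
  then show ?thesis by simp
qed

text \<open>Subtracting from \<open>f\<close> its tangent at \<open>x\<close> gives a smooth function that is minimal at \<open>x\<close>. One
  gradient step on it, started at \<open>y\<close>, decreases it by at least the left-hand side, by the quadratic
  upper bound, and cannot get below that minimum.\<close>

lemma gradient_gap_le_tangent_gap:
  "(norm (gradf y - gradf x))\<^sup>2 / (2 * L) \<le> f y - f x - gradf x \<bullet> (y - x)"
proof -
  define w where "w = gradf y - gradf x"
  let ?z = "y - (1 / L) *\<^sub>R w"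
  have "f x + gradf x \<bullet> (?z - x) \<le> f y + gradf y \<bullet> (?z - y) + L / 2 * (norm (?z - y))\<^sup>2"
    using above_tangent[of x ?z] below_parabola[of ?z y] by linarith
  moreover have "gradf x \<bullet> (?z - x) = gradf x \<bullet> (y - x) - (gradf x \<bullet> w) / L"
    by (simp add: inner_diff_right)
  moreover have "gradf y \<bullet> (?z - y) = - (gradf y \<bullet> w) / L"
    by simp
  moreover have "L / 2 * (norm (?z - y))\<^sup>2 = (norm w)\<^sup>2 / (2 * L)"
    using L_pos by (simp add: power_divide field_simps power2_eq_square)
  moreover have "(gradf y \<bullet> w) / L - (gradf x \<bullet> w) / L = (norm w)\<^sup>2 / L"
    by (simp add: w_def power2_norm_eq_inner inner_diff_left diff_divide_distrib)
  moreover have "(norm w)\<^sup>2 / L = 2 * ((norm w)\<^sup>2 / (2 * L))"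
    by simp
  ultimately show ?thesis
    unfolding w_def[symmetric] by linarith
qed

lemma gradient_cocoercive:
  "(norm (gradf x - gradf y))\<^sup>2 \<le> L * ((gradf x - gradf y) \<bullet> (x - y))"
proof -
  have "(norm (gradf y - gradf x))\<^sup>2 / (2 * L) + (norm (gradf x - gradf y))\<^sup>2 / (2 * L)
      \<le> (gradf x - gradf y) \<bullet> (x - y)"
    using gradient_gap_le_tangent_gap[of x y] gradient_gap_le_tangent_gap[of y x]
    by (simp add: inner_diff_left inner_diff_right)
  then show ?thesis
    using L_pos by (simp add: norm_minus_commute field_simps)
qed

text \<open>Cocoercivity makes a gradient step nonexpansive. The constant \<open>L\<close> here, rather than the \<open>2 * L\<close> of
  the triangle inequality, is what leaves a margin above the noise in \<open>step_above_noise\<close>.\<close>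

lemma norm_gradient_step_diff_le:
  "norm (L *\<^sub>R (x - y) - (gradf x - gradf y)) \<le> L * norm (x - y)"
proof (rule power2_le_imp_le)
  have "(norm (L *\<^sub>R (x - y) - (gradf x - gradf y)))\<^sup>2
      = (L * norm (x - y))\<^sup>2 - 2 * (L * ((gradf x - gradf y) \<bullet> (x - y)))
        + (norm (gradf x - gradf y))\<^sup>2"
    unfolding power_mult_distrib power2_norm_eq_inner
    by (simp add: inner_diff_left inner_diff_right inner_commute algebra_simps power2_eq_square)
  moreover have "0 \<le> L * ((gradf x - gradf y) \<bullet> (x - y))"
    using gradient_cocoercive[of x y] by (rule order_trans[rotated]) simp
  ultimately show "(norm (L *\<^sub>R (x - y) - (gradf x - gradf y)))\<^sup>2 \<le> (L * norm (x - y))\<^sup>2"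
    using gradient_cocoercive[of x y] by linarith
qed (use L_pos in simp)

section \<open>Proximal points\<close>

text \<open>Moving from the minimiser \<open>p\<close> towards \<open>y\<close> by the fraction \<open>t\<close> changes the quadratic term only to first
  order, up to \<open>t\<^sup>2\<close>, and changes \<open>r\<close> at most proportionally to \<open>t\<close> by convexity; dividing by \<open>t\<close> and
  letting it tend to zero gives the subgradient inequality.\<close>

lemma prox_subgradient:
  assumes prox: "is_prox a r v p" and a: "a > 0" and z: "r z \<noteq> \<infinity>"
  shows "r p \<noteq> \<infinity>" and "(1 / a) *\<^sub>R (v - p) \<in> subdifferential r p"
proof -
  have min: "ereal (1 / 2 * (norm (v - p))\<^sup>2) + ereal a * r p
      \<le> ereal (1 / 2 * (norm (v - y))\<^sup>2) + ereal a * r y" for y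
    using prox unfolding is_prox_def is_arg_min_def by (simp add: not_less)
  show p: "r p \<noteq> \<infinity>"
    using min[of z] z a r_range[of z] by (cases "r z") auto
  then obtain b where b: "r p = ereal b"
    using r_range[of p] by (cases "r p") auto
  have "r p + ereal (((1 / a) *\<^sub>R (v - p)) \<bullet> (y - p)) \<le> r y" for y
  proof (cases "r y")
    case (real c)
    define A where "A = (v - p) \<bullet> (y - p) - a * (c - b)"
    have bound: "A \<le> t * ((norm (y - p))\<^sup>2 / 2)" if t: "0 < t" "t \<le> 1" for t
    proof -
      let ?y = "(1 - t) *\<^sub>R p + t *\<^sub>R y"
      have "r ?y \<le> ereal (1 - t) * r p + ereal t * r y"
        using r_convex t unfolding ereal_convex_def by simp
      then have le: "r ?y \<le> ereal ((1 - t) * b + t * c)"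
        by (simp add: b real)
      then obtain b' where b': "r ?y = ereal b'" "b' \<le> (1 - t) * b + t * c"
        using r_range[of ?y] by (cases "r ?y") auto
      have "1 / 2 * (norm (v - p))\<^sup>2 + a * b \<le> 1 / 2 * (norm (v - ?y))\<^sup>2 + a * b'"
        using min[of ?y] by (simp add: b b')
      moreover have "a * b' \<le> a * ((1 - t) * b + t * c)"
        using b' a by simp
      moreover have "(norm (v - ?y))\<^sup>2
          = (norm (v - p))\<^sup>2 - 2 * t * ((v - p) \<bullet> (y - p)) + t\<^sup>2 * (norm (y - p))\<^sup>2"
      proof -
        have "v - ?y = (v - p) - t *\<^sub>R (y - p)"
          by (simp add: algebra_simps)
        then show ?thesis
          by (simp only: power2_norm_eq_inner)
            (simp add: inner_diff_left inner_diff_right inner_commute algebra_simps power2_eq_square)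
      qed
      ultimately have "t * A \<le> t * (t * ((norm (y - p))\<^sup>2 / 2))"
        unfolding A_def by (simp add: algebra_simps power2_eq_square)
      then show ?thesis
        using t by simp
    qed
    have "A \<le> 0"
    proof (rule tendsto_lowerbound)
      show "((\<lambda>t. t * ((norm (y - p))\<^sup>2 / 2)) \<longlongrightarrow> 0) (at_right 0)"
        by (auto intro!: tendsto_eq_intros)
      show "\<forall>\<^sub>F t in at_right 0. A \<le> t * ((norm (y - p))\<^sup>2 / 2)"
        unfolding eventually_at_right_field using bound by (intro exI[of _ 1]) auto
    qed simp
    then have "(v - p) \<bullet> (y - p) / a \<le> c - b"
      using a unfolding A_def by (simp add: field_simps)
    then show ?thesis
      by (simp add: b real)
  qed (use r_range in auto)
  then show "(1 / a) *\<^sub>R (v - p) \<in> subdifferential r p"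
    unfolding subdifferential_def by simp
qed

lemma composite_subgradient:
  assumes "v \<in> composite_subdifferential gradf r p"
  shows "F p + ereal (v \<bullet> (y - p)) \<le> F y"
proof -
  obtain w where w: "v = gradf p + w" "r p + ereal (w \<bullet> (y - p)) \<le> r y"
    using assms unfolding composite_subdifferential_def subdifferential_def by auto
  have "F p + ereal (v \<bullet> (y - p))
      = ereal (f p + gradf p \<bullet> (y - p)) + (r p + ereal (w \<bullet> (y - p)))"
    unfolding composite_def w(1) by (cases "r p") (auto simp: inner_add_left)
  also have "\<dots> \<le> ereal (f y) + r y"
    using above_tangent[of p y] w(2) by (intro add_mono) auto
  finally show ?thesis
    by (simp add: composite_def)
qed

lemma composite_convex:
  assumes "F x = ereal a" "F y = ereal b" "0 \<le> t" "t \<le> 1"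
  shows "F ((1 - t) *\<^sub>R x + t *\<^sub>R y) \<le> ereal ((1 - t) * a + t * b)"
proof -
  obtain a' b' where r: "r x = ereal a'" "r y = ereal b'"
    using assms(1,2) unfolding composite_def by (cases "r x"; cases "r y") auto
  have "f ((1 - t) *\<^sub>R x + t *\<^sub>R y) \<le> (1 - t) * f x + t * f y"
    by (rule convex_onD[OF f_convex]) (use assms in auto)
  moreover have "r ((1 - t) *\<^sub>R x + t *\<^sub>R y) \<le> ereal (1 - t) * r x + ereal t * r y"
    using r_convex assms(3,4) unfolding ereal_convex_def by simp
  ultimately have "F ((1 - t) *\<^sub>R x + t *\<^sub>R y)
      \<le> ereal ((1 - t) * f x + t * f y) + ereal ((1 - t) * a' + t * b')"
    unfolding composite_def by (intro add_mono) (auto simp: r)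
  also have "\<dots> = ereal ((1 - t) * a + t * b)"
    using assms(1,2) unfolding composite_def by (auto simp: r algebra_simps)
  finally show ?thesis .
qed

section \<open>One inexact step\<close>

definition noisy_step :: "real \<Rightarrow> 'a \<Rightarrow> 'a \<Rightarrow> bool" where
  "noisy_step s x p \<longleftrightarrow>
     (\<exists>g. norm (gradf x - g) \<le> s \<and> is_prox (1 / L) r (x - (1 / L) *\<^sub>R g) p)"

lemma noise_nonneg: "noisy_step s x p \<Longrightarrow> 0 \<le> s"
  using norm_ge_zero order_trans unfolding noisy_step_def by blast

text \<open>The point \<open>z\<close> only witnesses that \<open>F\<close> is finite somewhere, which makes proximal points
  finite.\<close>

context
  fixes s :: real and x p z :: 'a
  assumes step: "noisy_step s x p" and z: "F z \<noteq> \<infinity>"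
begin

lemma step_subgradient:
  obtains g where "norm (gradf x - g) \<le> s" "L *\<^sub>R (x - p) - g \<in> subdifferential r p"
proof -
  obtain g where g: "norm (gradf x - g) \<le> s" "is_prox (1 / L) r (x - (1 / L) *\<^sub>R g) p"
    using step unfolding noisy_step_def by blast
  have "r z \<noteq> \<infinity>"
    using z unfolding composite_def by auto
  from prox_subgradient(2)[OF g(2) _ this] L_pos
  have "L *\<^sub>R (x - p) - g \<in> subdifferential r p"
    by (simp add: algebra_simps)
  with g(1) show ?thesis by (rule that)
qed

lemma step_value_finite: "F p \<noteq> \<infinity>"
proof -
  obtain g where "is_prox (1 / L) r (x - (1 / L) *\<^sub>R g) p"
    using step unfolding noisy_step_def by blast
  moreover have "r z \<noteq> \<infinity>"
    using z unfolding composite_def by auto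
  ultimately show ?thesis
    using prox_subgradient(1) L_pos unfolding composite_def by auto
qed

text \<open>The optimality condition of the proximal step provides the subgradient
  \<open>L *\<^sub>R (x - p) - g\<close> of \<open>r\<close> at \<open>p\<close>. Adding the gradient at \<open>p\<close> leaves a difference of gradient
  steps and the gradient error.\<close>

lemma step_residual:
  "\<exists>v \<in> composite_subdifferential gradf r p. norm v \<le> L * norm (x - p) + s"
proof -
  obtain g where g: "norm (gradf x - g) \<le> s" "L *\<^sub>R (x - p) - g \<in> subdifferential r p"
    by (rule step_subgradient)
  have "gradf p + (L *\<^sub>R (x - p) - g)
      = (L *\<^sub>R (x - p) - (gradf x - gradf p)) + (gradf x - g)"
    by simp
  then have "norm (gradf p + (L *\<^sub>R (x - p) - g)) \<le> L * norm (x - p) + s"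
    using norm_triangle_le[OF add_mono[OF norm_gradient_step_diff_le g(1)]] by metis
  then show ?thesis
    using g(2) unfolding composite_subdifferential_def by blast
qed

text \<open>The quadratic upper bound at \<open>x\<close>, the tangent of \<open>f\<close> at \<open>x\<close> and the subgradient of \<open>r\<close> at \<open>p\<close>
  add up to this inequality, with the gradient error appearing in an inner product with \<open>p - y\<close>.\<close>

lemma step_three_point:
  "F p \<le> F y + ereal (s * norm (p - y) + L / 2 * ((norm (x - y))\<^sup>2 - (norm (p - y))\<^sup>2))"
proof (cases "r y")
  case (real c)
  obtain g where g: "norm (gradf x - g) \<le> s" "L *\<^sub>R (x - p) - g \<in> subdifferential r p"
    by (rule step_subgradient)
  let ?w = "L *\<^sub>R (x - p) - g"
  have "r p + ereal (?w \<bullet> (y - p)) \<le> ereal c"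
    using g(2) unfolding subdifferential_def real[symmetric] by simp
  then obtain b where b: "r p = ereal b" "b + ?w \<bullet> (y - p) \<le> c"
    using r_range[of p] by (cases "r p") auto
  have "f p \<le> f x + gradf x \<bullet> (p - x) + L / 2 * (norm (p - x))\<^sup>2"
    by (rule below_parabola)
  moreover have "f x + gradf x \<bullet> (y - x) \<le> f y"
    by (rule above_tangent)
  moreover have "(gradf x - g) \<bullet> (p - y) \<le> s * norm (p - y)"
    by (rule order_trans[OF norm_cauchy_schwarz mult_right_mono[OF g(1)]]) simp
  moreover have "gradf x \<bullet> (p - x) - gradf x \<bullet> (y - x) - ?w \<bullet> (y - p)
      + L / 2 * (norm (p - x))\<^sup>2
      = (gradf x - g) \<bullet> (p - y) + L / 2 * ((norm (x - y))\<^sup>2 - (norm (p - y))\<^sup>2)"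
    unfolding power2_norm_eq_inner
    by (simp add: inner_diff_left inner_diff_right inner_commute algebra_simps)
  ultimately show ?thesis
    using b(2) by (simp add: composite_def b(1) real)
qed (use r_range in \<open>auto simp: composite_def\<close>)

text \<open>Completing the square: the term \<open>- L / 2 * (norm (p - y))\<^sup>2\<close> of the three-point inequality absorbs
  the gradient error.\<close>

lemma step_no_worse_than:
  "F p \<le> F y + ereal (L / 2 * (norm (x - y))\<^sup>2 + s\<^sup>2 / (2 * L))"
proof -
  let ?h = "norm (p - y)"
  have "0 \<le> (s - L * ?h)\<^sup>2 / (2 * L)"
    using L_pos by simp
  also have "\<dots> = s\<^sup>2 / (2 * L) - s * ?h + L / 2 * ?h\<^sup>2"
    using L_pos by (simp add: power2_eq_square field_simps)
  finally have "ereal (s * ?h + L / 2 * ((norm (x - y))\<^sup>2 - ?h\<^sup>2))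
      \<le> ereal (L / 2 * (norm (x - y))\<^sup>2 + s\<^sup>2 / (2 * L))"
    by (simp add: algebra_simps)
  then show ?thesis
    using step_three_point[of y] by (meson add_left_mono order_trans)
qed

lemma step_descent:
  "F p \<le> F x + ereal (s * norm (x - p) - L / 2 * (norm (x - p))\<^sup>2)"
proof -
  have "s * norm (p - x) + L / 2 * ((norm (x - x))\<^sup>2 - (norm (p - x))\<^sup>2)
      = s * norm (x - p) - L / 2 * (norm (x - p))\<^sup>2"
    by (simp add: norm_minus_commute)
  with step_three_point[of x] show ?thesis by metis
qed

lemma long_step_decreases:
  assumes "2 * s \<le> L * norm (x - p)"
  shows "F p \<le> F x"
proof -
  have "s * norm (x - p) \<le> L * norm (x - p) / 2 * norm (x - p)"
    using assms by (intro mult_right_mono) auto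
  then have "F x + ereal (s * norm (x - p) - L / 2 * (norm (x - p))\<^sup>2) \<le> F x + 0"
    by (intro add_left_mono) (simp add: power2_eq_square)
  with step_descent show ?thesis
    by simp
qed

end

lemma step_gap_contraction:
  assumes step: "noisy_step s x p"
    and gaps: "F x = ereal (m + e)" "F p = ereal (m + E)" "F z = ereal m"
    and t: "0 \<le> t" "t \<le> 1"
  shows "E \<le> (1 - t) * e + L / 2 * t\<^sup>2 * (norm (x - z))\<^sup>2 + s\<^sup>2 / (2 * L)"
proof -
  let ?y = "(1 - t) *\<^sub>R x + t *\<^sub>R z"
  let ?c = "L / 2 * (norm (x - ?y))\<^sup>2 + s\<^sup>2 / (2 * L)"
  have "F p \<le> F ?y + ereal ?c"
    by (rule step_no_worse_than[OF step, of z]) (simp add: gaps(3))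
  also have "\<dots> \<le> ereal ((1 - t) * (m + e) + t * m) + ereal ?c"
    by (intro add_right_mono composite_convex gaps t)
  finally have "E \<le> (1 - t) * e + ?c"
    by (simp add: gaps algebra_simps)
  moreover have "x - ?y = t *\<^sub>R (x - z)"
    by (simp add: algebra_simps)
  ultimately show ?thesis
    using t by (simp add: power_mult_distrib)
qed

text \<open>By the residual bound, \<open>E \<le> (L * norm (x - p) + s) * norm (p - z')\<close>. A gap above the noise
  level therefore gives \<open>L * norm (x - p) \<ge> (sqrt 10 - 1) * s\<close>, and \<open>sqrt 10 - 1\<close> is just large enough
  for \<open>steep_step_bound\<close>. The solutions \<open>z\<close> and \<open>z'\<close> may differ: each point is compared with a
  solution close to itself.\<close>

lemma step_above_noise:
  assumes step: "noisy_step s x p"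
    and gaps: "F x = ereal (m + e)" "F p = ereal (m + E)" "F z = ereal m" "F z' = ereal m"
    and E: "0 < E" and noise: "10 * s\<^sup>2 * (norm (p - z'))\<^sup>2 \<le> E\<^sup>2"
  shows "E \<le> e" and "E \<le> 2 * L * (norm (x - z))\<^sup>2"
proof -
  have fin: "F z \<noteq> \<infinity>"
    using gaps(3) by simp
  have s: "0 \<le> s"
    by (rule noise_nonneg[OF step])
  define a where "a = L * norm (x - p)"
  have a: "0 \<le> a"
    using L_pos unfolding a_def by simp
  obtain v where v: "v \<in> composite_subdifferential gradf r p" "norm v \<le> a + s"
    using step_residual[OF step fin] unfolding a_def by blast
  have "E \<le> v \<bullet> (p - z')"
    using composite_subgradient[OF v(1), of z'] by (simp add: gaps inner_diff_right)
  also have "\<dots> \<le> (a + s) * norm (p - z')"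
    by (rule order_trans[OF norm_cauchy_schwarz mult_right_mono[OF v(2)]]) simp
  finally have E_le: "E \<le> (a + s) * norm (p - z')" .
  then have pos: "0 < norm (p - z')"
    using E by (cases "norm (p - z') = 0") auto
  have "10 * s\<^sup>2 * (norm (p - z'))\<^sup>2 \<le> (a + s)\<^sup>2 * (norm (p - z'))\<^sup>2"
    using noise power_mono[OF E_le, of 2] E by (simp add: power_mult_distrib)
  then have "10 * s\<^sup>2 \<le> (a + s)\<^sup>2"
    using pos by simp
  moreover have "(79 / 25 * s)\<^sup>2 \<le> 10 * s\<^sup>2"
    using zero_le_power2[of s] by (simp add: power_mult_distrib power_divide)
  ultimately have "(79 / 25 * s)\<^sup>2 \<le> (a + s)\<^sup>2"
    by (rule order_trans[rotated])
  then have "79 / 25 * s \<le> a + s"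
    by (rule power2_le_imp_le) (use a s in simp)
  then have steep: "54 / 25 * s \<le> a"
    by linarith
  then have "2 * s \<le> L * norm (x - p)"
    using s unfolding a_def by linarith
  then have "F p \<le> F x"
    by (rule long_step_decreases[OF step fin])
  then show "E \<le> e"
    by (simp add: gaps)
  have "E \<le> s * norm (p - z) + L / 2 * ((norm (x - z))\<^sup>2 - (norm (p - z))\<^sup>2)"
    using step_three_point[OF step fin, of z] by (simp add: gaps)
  then have "L * E \<le> L * (s * norm (p - z) + L / 2 * ((norm (x - z))\<^sup>2 - (norm (p - z))\<^sup>2))"
    using L_pos by (intro mult_left_mono) auto
  also have "\<dots> = s * (L * norm (p - z)) + ((L * norm (x - z))\<^sup>2 - (L * norm (p - z))\<^sup>2) / 2"
    by (simp add: field_simps power2_eq_square)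
  finally have "L * E \<le> 2 * (L * norm (x - z))\<^sup>2"
  proof (rule steep_step_bound[OF _ _ steep s])
    have "norm (x - p) \<le> norm (x - z) + norm (p - z)"
      using norm_triangle_ineq4[of "x - z" "p - z"] by simp
    then have "a \<le> L * (norm (x - z) + norm (p - z))"
      using L_pos unfolding a_def by (intro mult_left_mono) auto
    then show "a \<le> L * norm (x - z) + L * norm (p - z)"
      by (simp add: distrib_left)
  qed (use L_pos in simp)
  then have "L * E \<le> L * (2 * L * (norm (x - z))\<^sup>2)"
    by (simp add: power_mult_distrib power2_eq_square algebra_simps)
  then show "E \<le> 2 * L * (norm (x - z))\<^sup>2"
    using L_pos by simp
qed

section \<open>Rates of convergence\<close>

definition noisy_run :: "real \<Rightarrow> (nat \<Rightarrow> 'a) \<Rightarrow> bool" where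
  "noisy_run s x \<longleftrightarrow> (\<forall>k. noisy_step s (x k) (x (Suc k)))"

lemma noisy_run_gaps:
  assumes run: "noisy_run s x" and start: "F (x 0) = ereal (m + e0)"
    and min: "\<And>y. ereal m \<le> F y"
  obtains e where "\<And>k. F (x k) = ereal (m + e k)" "\<And>k. 0 \<le> e k" "e 0 = e0"
proof -
  have "F (x k) \<noteq> \<infinity>" for k
  proof (induction k)
    case (Suc k)
    then show ?case
      using run step_value_finite[of s "x k" "x (Suc k)" "x k"] unfolding noisy_run_def by blast
  qed (simp add: start)
  then have "\<exists>b. F (x k) = ereal (m + b) \<and> 0 \<le> b" for k
    using min[of "x k"] by (cases "F (x k)") (auto intro!: exI[of _ "real_of_ereal (F (x k)) - m"])
  then obtain e where "\<And>k. F (x k) = ereal (m + e k) \<and> 0 \<le> e k"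
    by metis
  then show ?thesis
    using that[of e] start by auto
qed

text \<open>As long as the gap exceeds the noise level \<open>B\<close> it decreases, so all earlier gaps exceed \<open>B\<close> too
  and the growth of the reciprocal gap adds up over all \<open>k\<close> iterations. The bound is decreasing in
  the count \<open>j\<close>, so that crediting fewer iterations, as with a burn-in, is sound.\<close>

theorem sublinear_rate:
  assumes run: "noisy_run s x" and start: "F (x 0) = ereal (m + e0)"
    and min: "\<And>y. ereal m \<le> F y" and sol: "\<And>y. F (P y) = ereal m"
    and R: "\<And>k. norm (x k - P (x k)) \<le> R" and j: "0 \<le> j" "j \<le> real k"
  shows "F (x k) \<le> ereal (m + max (36 * L * R\<^sup>2 * e0 / (e0 * j + 36 * L * R\<^sup>2)) (R * (sqrt 10 * s)))"
proof -
  obtain e where e: "\<And>k. F (x k) = ereal (m + e k)" "\<And>k. 0 \<le> e k" "e 0 = e0"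
    using noisy_run_gaps[OF run start min] by blast
  have step: "noisy_step s (x k) (x (Suc k))" for k
    using run unfolding noisy_run_def by blast
  have s: "0 \<le> s"
    by (rule noise_nonneg[OF step])
  have R0: "0 \<le> R"
    using R[of 0] norm_ge_zero order_trans by blast
  define B where "B = R * (sqrt 10 * s)"
  have B: "0 \<le> B"
    using R0 s unfolding B_def by simp
  define N where "N = L * R\<^sup>2"
  \<comment> \<open>If \<open>R\<close> is zero, every iterate is a solution.\<close>
  have Rpos: "0 < R" if "B < e k" for k
  proof (rule ccontr)
    assume "\<not> 0 < R"
    then have "x k = P (x k)"
      using R[of k] R0 by simp
    then have "e k = 0"
      using sol[of "x k"] e(1)[of k] by simp
    then show False
      using that B by simp
  qed
  have "e k \<le> e0 \<and> 1 / e0 + 9 / (20 * N) * real k \<le> 1 / e k" if "B < e k"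
    using that
  proof (induction k)
    case (Suc k)
    let ?E = "e (Suc k)"
    have pos: "0 < ?E"
      using Suc.prems B by simp
    have N: "0 < N"
      using Rpos[OF Suc.prems] L_pos unfolding N_def by simp
    have "B\<^sup>2 \<le> ?E\<^sup>2"
      using Suc.prems B by (intro power_mono) auto
    then have noise: "10 * s\<^sup>2 * R\<^sup>2 \<le> ?E\<^sup>2"
      unfolding B_def by (simp add: power_mult_distrib mult_ac)
    have D: "(norm (x k - P (x k)))\<^sup>2 \<le> R\<^sup>2" for k
      using R[of k] by (intro power_mono) auto
    have "10 * s\<^sup>2 * (norm (x (Suc k) - P (x (Suc k))))\<^sup>2 \<le> ?E\<^sup>2"
      by (rule order_trans[OF mult_left_mono[OF D] noise]) simp
    note far = step_above_noise[OF step e(1) e(1) sol[of "x k"] sol pos this]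
    have "?E \<le> 2 * N"
      unfolding N_def using mult_left_mono[OF D[of k], of "2 * L"] far(2) L_pos by linarith
    moreover have "?E \<le> (1 - t) * e k + N / 2 * t\<^sup>2 + ?E\<^sup>2 / (20 * N)"
      if t: "0 \<le> t" "t \<le> 1" for t
    proof -
      have "?E \<le> (1 - t) * e k + L / 2 * t\<^sup>2 * (norm (x k - P (x k)))\<^sup>2 + s\<^sup>2 / (2 * L)"
        by (rule step_gap_contraction[OF step e(1) e(1) sol t])
      moreover have "L / 2 * t\<^sup>2 * (norm (x k - P (x k)))\<^sup>2 \<le> L / 2 * t\<^sup>2 * R\<^sup>2"
        using L_pos by (intro mult_left_mono D) auto
      moreover have "s\<^sup>2 / (2 * L) \<le> ?E\<^sup>2 / (20 * N)"
        using noise L_pos Rpos[OF Suc.prems] unfolding N_def by (simp add: field_simps)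
      ultimately show ?thesis
        unfolding N_def by (simp add: mult_ac)
    qed
    ultimately have "1 / e k + 9 / (20 * N) \<le> 1 / ?E"
      using pos far(1) by (intro reciprocal_gap_growth)
    moreover have "B < e k"
      using Suc.prems far(1) by simp
    ultimately show ?case
      using Suc.IH far(1) by (simp add: algebra_simps add_divide_distrib)
  qed (simp add: e(3))
  note growth = this
  have "e k \<le> max (36 * N * e0 / (e0 * j + 36 * N)) B"
  proof (cases "B < e k")
    case True
    have N: "0 < N"
      using Rpos[OF True] L_pos unfolding N_def by simp
    have ek: "0 < e k"
      using True B by simp
    have "0 < e0"
      using growth[OF True] ek by simp
    have "j / (36 * N) \<le> 9 / (20 * N) * real k"
      using j N by (simp add: field_simps)
    then have "1 / e0 + j / (36 * N) \<le> 1 / e k"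
      using growth[OF True] by linarith
    moreover have "1 / e0 + j / (36 * N) = (e0 * j + 36 * N) / (36 * N * e0)"
      using N \<open>0 < e0\<close> by (simp add: field_simps)
    ultimately have "e k \<le> 36 * N * e0 / (e0 * j + 36 * N)"
      using ek N \<open>0 < e0\<close> j by (simp add: pos_le_divide_eq add_nonneg_pos divide_le_eq mult_ac)
    then show ?thesis
      by simp
  qed simp
  then show ?thesis
    unfolding e(1) N_def B_def by (simp add: mult.assoc)
qed

text \<open>Every gap is either below the noise level \<open>B\<close> or at most \<open>q\<close> times its predecessor. Thus noise
  does not accumulate: the maximum of \<open>q ^ k * e0\<close> and \<open>B\<close> is preserved.\<close>

theorem linear_rate:
  assumes run: "noisy_run s x" and start: "F (x 0) = ereal (m + e0)"
    and min: "\<And>y. ereal m \<le> F y" and sol: "\<And>y. F (P y) = ereal m"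
    and \<nu>: "0 < \<nu>" and growth: "\<And>y. F y - ereal m \<ge> ereal (\<nu> / 2 * (norm (y - P y))\<^sup>2)"
  shows "F (x k) \<le> ereal (m + ((24 * L / (\<nu> + 24 * L)) ^ k * e0 + 20 * s\<^sup>2 / \<nu>))"
proof -
  obtain e where e: "\<And>k. F (x k) = ereal (m + e k)" "\<And>k. 0 \<le> e k" "e 0 = e0"
    using noisy_run_gaps[OF run start min] by blast
  have step: "noisy_step s (x k) (x (Suc k))" for k
    using run unfolding noisy_run_def by blast
  define q where "q = 24 * L / (\<nu> + 24 * L)"
  have q: "0 \<le> q" "q \<le> 1"
    using L_pos \<nu> unfolding q_def by auto
  define B where "B = 20 * s\<^sup>2 / \<nu>"
  have B: "0 \<le> B"
    using \<nu> unfolding B_def by simp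
  have D: "(norm (x k - P (x k)))\<^sup>2 \<le> 2 * e k / \<nu>" for k
    using growth[of "x k"] \<nu> by (simp add: e(1) field_simps)
  have decrease: "e (Suc k) \<le> q * e k" if above: "B < e (Suc k)" for k
  proof -
    let ?E = "e (Suc k)"
    have pos: "0 < ?E"
      using above B by simp
    have noise: "20 * s\<^sup>2 \<le> \<nu> * ?E"
      using above \<nu> unfolding B_def by (simp add: field_simps)
    have "10 * s\<^sup>2 * (norm (x (Suc k) - P (x (Suc k))))\<^sup>2 \<le> 10 * s\<^sup>2 * (2 * ?E / \<nu>)"
      by (intro mult_left_mono D) simp
    also have "\<dots> = 20 * s\<^sup>2 * (?E / \<nu>)"
      by simp
    also have "\<dots> \<le> \<nu> * ?E * (?E / \<nu>)"
      using noise pos \<nu> by (intro mult_right_mono) auto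
    also have "\<dots> = ?E\<^sup>2"
      using \<nu> by (simp add: power2_eq_square)
    finally have "?E \<le> 2 * L * (norm (x k - P (x k)))\<^sup>2"
      by (rule step_above_noise(2)[OF step e(1) e(1) sol[of "x k"] sol pos])
    also have "\<dots> \<le> 2 * L * (2 * e k / \<nu>)"
      using L_pos by (intro mult_left_mono D) auto
    finally have far: "?E \<le> 4 * L * e k / \<nu>"
      by simp
    have "?E \<le> (1 - t) * e k + L * t\<^sup>2 * e k / \<nu> + \<nu> * ?E / (40 * L)"
      if t: "0 \<le> t" "t \<le> 1" for t
    proof -
      have "?E \<le> (1 - t) * e k + L / 2 * t\<^sup>2 * (norm (x k - P (x k)))\<^sup>2 + s\<^sup>2 / (2 * L)"
        by (rule step_gap_contraction[OF step e(1) e(1) sol t])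
      moreover have "L / 2 * t\<^sup>2 * (norm (x k - P (x k)))\<^sup>2 \<le> L / 2 * t\<^sup>2 * (2 * e k / \<nu>)"
        using L_pos by (intro mult_left_mono D) auto
      moreover have "s\<^sup>2 / (2 * L) \<le> \<nu> * ?E / (40 * L)"
        using noise L_pos by (simp add: field_simps)
      ultimately show ?thesis
        by simp
    qed
    then show ?thesis
      unfolding q_def by (rule linear_gap_decrease[OF e(2) L_pos \<nu> far])
  qed
  have "e k \<le> max (q ^ k * e0) B"
  proof (induction k)
    case (Suc k)
    show ?case
    proof (cases "B < e (Suc k)")
      case True
      have "e (Suc k) \<le> q * max (q ^ k * e0) B"
        using decrease[OF True] mult_left_mono[OF Suc q(1)] by simp
      also have "\<dots> = max (q ^ Suc k * e0) (q * B)"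
        using q(1) by (simp add: max_mult_distrib_left mult.assoc)
      also have "\<dots> \<le> max (q ^ Suc k * e0) B"
        using mult_right_mono[OF q(2) B] by (simp add: max.coboundedI2)
      finally show ?thesis .
    qed simp
  qed (simp add: e(3))
  moreover have "0 \<le> q ^ k * e0"
    using q(1) e(2)[of 0] e(3) by simp
  ultimately have "e k \<le> q ^ k * e0 + B"
    using B by auto
  then show ?thesis
    by (simp add: e(1) q_def B_def)
qed

section \<open>Boundedness of the iterates\<close>

text \<open>The level is the same for all runs from \<open>x0\<close>. The bound starts at the first iterate because
  \<open>F x0\<close> may be infinite. The threshold \<open>3 * s\<close> for the subgradients is the residual of a step of length
  \<open>2 * s / L\<close>, at which descent outweighs the noise.\<close>

lemma noisy_run_bounded_values:
  assumes coercive: "subdiff_coercive F (composite_subdifferential gradf r)"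
    and z: "F z = ereal m"
  obtains c where "\<And>x k. noisy_run s x \<Longrightarrow> x 0 = x0 \<Longrightarrow> F (x (Suc k)) \<le> ereal c"
proof -
  obtain c1 where c1: "\<And>y u. ereal c1 \<le> F y \<Longrightarrow> u \<in> composite_subdifferential gradf r y
      \<Longrightarrow> 3 * s < norm u"
    using subgradients_large_on_high_levels[OF coercive] by blast
  define c where "c = max c1 (m + (L / 2 * (norm (x0 - z))\<^sup>2 + s\<^sup>2 / (2 * L)))"
  have fin: "F z \<noteq> \<infinity>"
    using z by simp
  have "F (x (Suc k)) \<le> ereal c" if run: "noisy_run s x" "x 0 = x0" for x k
  proof (induction k)
    case 0
    have "noisy_step s x0 (x (Suc 0))"
      using run(1) unfolding noisy_run_def run(2)[symmetric] by blast
    from step_no_worse_than[OF this fin, of z]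
    have "F (x (Suc 0)) \<le> ereal (m + (L / 2 * (norm (x0 - z))\<^sup>2 + s\<^sup>2 / (2 * L)))"
      by (simp add: z)
    also have "\<dots> \<le> ereal c"
      unfolding c_def by simp
    finally show ?case .
  next
    case (Suc k)
    let ?x = "x (Suc k)" and ?p = "x (Suc (Suc k))"
    have step: "noisy_step s ?x ?p"
      using run unfolding noisy_run_def by blast
    show ?case
    proof (cases "ereal c1 \<le> F ?p")
      case True
      obtain v where v: "v \<in> composite_subdifferential gradf r ?p"
          "norm v \<le> L * norm (?x - ?p) + s"
        using step_residual[OF step fin] by blast
      have "2 * s \<le> L * norm (?x - ?p)"
        using c1[OF True v(1)] v(2) by simp
      then have "F ?p \<le> F ?x"
        by (rule long_step_decreases[OF step fin])
      with Suc show ?thesis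
        by simp
    next
      case False
      moreover have "ereal c1 \<le> ereal c"
        unfolding c_def by simp
      ultimately show ?thesis
        by (meson linear order_trans)
    qed
  qed
  then show ?thesis
    by (rule that)
qed

lemma inexact_prox_gradient_noisy_run:
  assumes "inexact_prox_gradient gradf r L \<epsilon> x0 x g"
  shows "noisy_run (sqrt \<epsilon>) x" "x 0 = x0"
  using assms real_le_rsqrt
  unfolding inexact_prox_gradient_def noisy_run_def noisy_step_def by blast+

end

lemma ereal_gap_le:
  assumes "a \<le> ereal (m + b)"
  shows "a - ereal m \<le> ereal b"
  using assms by (cases a) auto

lemma ereal_infinity_le_scaled:
  fixes a b :: real
  assumes "0 < a"
  shows "\<infinity> \<le> ereal a * \<infinity> + ereal b"
  using assms by simp

section \<open>Convergence of the inexact proximal gradient method\<close>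

theorem theorem4p1:
  fixes f :: "real ^ 'd \<Rightarrow> real"
    and gradf :: "real ^ 'd \<Rightarrow> real ^ 'd"
    and r :: "real ^ 'd \<Rightarrow> ereal"
    and F :: "real ^ 'd \<Rightarrow> ereal"
    and P :: "real ^ 'd \<Rightarrow> real ^ 'd"
    and L \<epsilon> :: real
    and x0 :: "real ^ 'd"
  assumes f_convex: "convex_on UNIV f"
    and f_grad: "\<And>x. GDERIV f x :> gradf x"
    and L_pos: "L > 0"
    and f_smooth: "\<And>x y. norm (gradf x - gradf y) \<le> L * norm (x - y)"
    and r_range: "\<And>x. r x \<noteq> -\<infinity>"
    and r_convex: "ereal_convex r"
    and F_eq: "F = composite f r"
    and sol_nonempty: "solution_set F \<noteq> {}"
    and P_proj: "projects_onto P (solution_set F)"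
    and eps_nonneg: "\<epsilon> \<ge> 0"
  shows
    "(coercive F P \<and> subdiff_coercive F (composite_subdifferential gradf r) \<longrightarrow>
        (\<exists>R. \<forall>x g. inexact_prox_gradient gradf r L \<epsilon> x0 x g \<longrightarrow>
               (\<forall>k. norm (x k - P (x k)) \<le> R)) \<and>
        (\<forall>R x g e0. inexact_prox_gradient gradf r L \<epsilon> x0 x g \<longrightarrow>
               (\<forall>k. norm (x k - P (x k)) \<le> R) \<longrightarrow>
               F (x 0) - opt_value F = ereal e0 \<longrightarrow>
               (\<forall>k \<ge> burn_in e0.
                  F (x k) - opt_value F \<le>
                    ereal (max (36 * L * R\<^sup>2 * e0 / (e0 * (real k - real (burn_in e0)) + 36 * L * R\<^sup>2))
                               (R * sqrt (10 * \<epsilon>))))))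
     \<and>
     (\<forall>\<nu> > 0. restricted_strongly_convex \<nu> F P \<longrightarrow>
        (\<forall>x g. inexact_prox_gradient gradf r L \<epsilon> x0 x g \<longrightarrow>
               (\<forall>k. F (x k) - opt_value F \<le>
                      ereal ((24 * L / (\<nu> + 24 * L)) ^ k) * (F (x 0) - opt_value F)
                      + ereal (20 * \<epsilon> / \<nu>))))"
proof -
  interpret composite_problem f gradf r L
    by unfold_locales (fact f_convex f_grad L_pos f_smooth r_range r_convex)+
  have opt_le: "opt_value F \<le> F y" for y
    unfolding opt_value_def by (simp add: INF_lower)
  have P_sol: "F (P y) = opt_value F" for y
    using P_proj unfolding projects_onto_def is_arg_min_def solution_set_def by auto
  have not_minus_infinity: "opt_value F \<noteq> -\<infinity>"
    using P_sol[of 0] r_range[of "P 0"] unfolding F_eq composite_def by (cases "r (P 0)") auto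
  show ?thesis
  proof (cases "opt_value F")
    \<comment> \<open>Here \<open>r\<close> is infinite everywhere: every point is a solution and all gaps are
      \<open>\<infinity> - \<infinity> = \<infinity>\<close>.\<close>
    case PInf
    have F_top: "F y = \<infinity>" for y
      using opt_le[of y] PInf by simp
    have "norm (y - P y) \<le> 0" for y
    proof -
      have "y \<in> solution_set F"
        unfolding solution_set_def by (simp add: F_top PInf)
      then show ?thesis
        using P_proj unfolding projects_onto_def is_arg_min_def
        by (metis norm_minus_commute diff_self norm_zero not_less)
    qed
    moreover have "\<infinity> \<le> ereal ((24 * L / (\<nu> + 24 * L)) ^ k) * \<infinity> + ereal b" if "0 < \<nu>" for \<nu> b k
      using ereal_infinity_le_scaled[of "(24 * L / (\<nu> + 24 * L)) ^ k"] that L_pos by simp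
    ultimately show ?thesis
      unfolding F_top PInf by (intro conjI impI exI[of _ 0]) auto
  next
    case MInf
    then show ?thesis
      using not_minus_infinity by simp
  next
    case (real m)
    have min: "\<And>y. ereal m \<le> composite f r y" and sol: "\<And>y. composite f r (P y) = ereal m"
      using opt_le P_sol real unfolding F_eq by metis+
    show ?thesis
    proof (intro conjI impI allI)
      assume coercive: "coercive F P \<and> subdiff_coercive F (composite_subdifferential gradf r)"
      obtain c where c: "\<And>x k. noisy_run (sqrt \<epsilon>) x \<Longrightarrow> x 0 = x0 \<Longrightarrow> F (x (Suc k)) \<le> ereal c"
        using noisy_run_bounded_values[OF _ sol] coercive unfolding F_eq by blast
      obtain R where R: "\<And>y. F y \<le> ereal c \<Longrightarrow> norm (y - P y) \<le> R"
        using coercive_sublevel_bounded coercive by blast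
      show "\<exists>R. \<forall>x g. inexact_prox_gradient gradf r L \<epsilon> x0 x g \<longrightarrow> (\<forall>k. norm (x k - P (x k)) \<le> R)"
      proof (intro exI allI impI)
        fix x g k
        assume "inexact_prox_gradient gradf r L \<epsilon> x0 x g"
        note run = inexact_prox_gradient_noisy_run[OF this]
        show "norm (x k - P (x k)) \<le> max (norm (x0 - P x0)) R"
          using R[OF c[OF run]] run(2) by (cases k) (auto simp: le_max_iff_disj)
      qed
    next
      fix R x g e0 k
      assume run: "inexact_prox_gradient gradf r L \<epsilon> x0 x g"
        and R: "\<forall>k. norm (x k - P (x k)) \<le> R"
        and start: "F (x 0) - opt_value F = ereal e0"
        and k: "burn_in e0 \<le> k"
      have "composite f r (x 0) = ereal (m + e0)"
        using start unfolding real unfolding F_eq by (cases "composite f r (x 0)") auto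
      from sublinear_rate[OF inexact_prox_gradient_noisy_run(1)[OF run] this min sol R[rule_format],
          of "real k - real (burn_in e0)" k]
      have "F (x k) \<le> ereal (m + max
          (36 * L * R\<^sup>2 * e0 / (e0 * (real k - real (burn_in e0)) + 36 * L * R\<^sup>2))
          (R * sqrt (10 * \<epsilon>)))"
        using k unfolding F_eq by (simp add: real_sqrt_mult)
      then show "F (x k) - opt_value F \<le> ereal (max
          (36 * L * R\<^sup>2 * e0 / (e0 * (real k - real (burn_in e0)) + 36 * L * R\<^sup>2))
          (R * sqrt (10 * \<epsilon>)))"
        unfolding real by (rule ereal_gap_le)
    next
      fix \<nu> x g k
      assume \<nu>: "0 < \<nu>" and growth: "restricted_strongly_convex \<nu> F P"
        and run: "inexact_prox_gradient gradf r L \<epsilon> x0 x g"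
      show "F (x k) - opt_value F \<le> ereal ((24 * L / (\<nu> + 24 * L)) ^ k) * (F (x 0) - opt_value F)
          + ereal (20 * \<epsilon> / \<nu>)"
      proof (cases "F (x 0)")
        case (real b)
        have "composite f r (x 0) = ereal (m + (b - m))"
          using real unfolding F_eq by simp
        from linear_rate[OF inexact_prox_gradient_noisy_run(1)[OF run] this min, where P = P and k = k, OF sol \<nu>]
        have "F (x k) \<le> ereal (m + ((24 * L / (\<nu> + 24 * L)) ^ k * (b - m) + 20 * \<epsilon> / \<nu>))"
          using growth[unfolded restricted_strongly_convex_def \<open>opt_value F = ereal m\<close>] eps_nonneg
          unfolding F_eq by simp
        then have "F (x k) - ereal m \<le> ereal ((24 * L / (\<nu> + 24 * L)) ^ k * (b - m) + 20 * \<epsilon> / \<nu>)"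
          by (rule ereal_gap_le)
        then show ?thesis
          unfolding \<open>opt_value F = ereal m\<close> real by simp
      next
        case PInf
        have "\<infinity> \<le> ereal ((24 * L / (\<nu> + 24 * L)) ^ k) * \<infinity> + ereal (20 * \<epsilon> / \<nu>)"
          using \<nu> L_pos by (intro ereal_infinity_le_scaled) simp
        then show ?thesis
          unfolding PInf \<open>opt_value F = ereal m\<close> by simp
      next
        case MInf
        then show ?thesis
          using opt_le[of "x 0"] not_minus_infinity by simp
      qed
    qed
  qed
qed

end
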